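(* Let $N\ge2$. Every $A_N$-invariant tropical polynomial on $\mathbb{R}^N$ of degree less than $\binom N2$ is $S_N$-invariant. The threshold is exact: the $A_N$-trace $f_{z^\ast}$ with $z^\ast=(0,1,\dots,N-1)$ has degree $\binom N2$ and satisfies $f_{z^\ast}(x)\ne f_{z^\ast}(\rho\cdot x)$ for every transposition $\rho\in S_N$ and every $x\in\mathbb{R}^N$ with pairwise distinct entries.
   Context: $S_N$ and the alternating group $A_N\le S_N$ act on $\mathbb{R}^N$ by permuting coordinates. The $A_N$-trace with template $z$ is $f_z(x):=\max_{g\in A_N}\langle x,g\cdot z\rangle$. A tropical polynomial on $\mathbb{R}^N$ is a finite maximum $\max_j\ell_j$ of functions $\ell_j(x)=\gamma_j+\langle a_j,x\rangle$ with $\gamma_j\in\mathbb{R}$, $a_j\in\mathbb{Z}_{\ge0}^N$, regarded as a function; its degree is the smallest value, over all such representations, of $\max_j\|a_j\|_1$. *)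

theory Defs
  imports "HOL-Analysis.Analysis"
begin

text \<open>\<open>\<real>\<^sup>N\<close> is \<open>real ^ 'n\<close> with \<open>N = CARD('n)\<close>; \<open>S\<^sub>N\<close> and \<open>A\<^sub>N\<close> are the groups of all, respectively
  all even, permutations of the index type.\<close>

definition sym_perms :: "('n::finite \<Rightarrow> 'n) set" where
  "sym_perms = {g. g permutes UNIV}"

definition alt_perms :: "('n::finite \<Rightarrow> 'n) set" where
  "alt_perms = {g. g permutes UNIV \<and> evenperm g}"

text \<open>The left action moves the entry at position \<open>i\<close> to position \<open>g i\<close>.\<close>

definition perm_act :: "('n::finite \<Rightarrow> 'n) \<Rightarrow> real ^ 'n \<Rightarrow> real ^ 'n" where
  "perm_act g x = (\<chi> i. x $ (inv g i))"

definition invariant_under :: "('n::finite \<Rightarrow> 'n) set \<Rightarrow> (real ^ 'n \<Rightarrow> real) \<Rightarrow> bool" where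
  "invariant_under G f \<longleftrightarrow> (\<forall>g\<in>G. \<forall>x. f (perm_act g x) = f x)"

definition alt_trace :: "real ^ 'n::finite \<Rightarrow> real ^ 'n \<Rightarrow> real" where
  "alt_trace z x = Max ((\<lambda>g. x \<bullet> perm_act g z) ` alt_perms)"

text \<open>A representation is a finite nonempty set of pairs \<open>(\<gamma>, a)\<close>, each standing for the affine
  function \<open>x \<mapsto> \<gamma> + \<langle>a, x\<rangle>\<close>. Distinct pairs may share the exponent vector \<open>a\<close>.\<close>

definition trop_rep :: "(real \<times> (nat ^ 'n::finite)) set \<Rightarrow> (real ^ 'n \<Rightarrow> real) \<Rightarrow> bool" where
  "trop_rep T f \<longleftrightarrow> finite T \<and> T \<noteq> {} \<and>
     (\<forall>x. f x = Max ((\<lambda>(\<gamma>, a). \<gamma> + (\<chi> i. real (a $ i)) \<bullet> x) ` T))"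

definition rep_degree :: "(real \<times> (nat ^ 'n::finite)) set \<Rightarrow> nat" where
  "rep_degree T = Max ((\<lambda>(\<gamma>, a). \<Sum>i\<in>UNIV. a $ i) ` T)"

definition tropical_polynomial :: "(real ^ 'n::finite \<Rightarrow> real) \<Rightarrow> bool" where
  "tropical_polynomial f \<longleftrightarrow> (\<exists>T. trop_rep T f)"

text \<open>Meaningful only for tropical polynomials; elsewhere the value is unspecified.\<close>

definition trop_degree :: "(real ^ 'n::finite \<Rightarrow> real) \<Rightarrow> nat" where
  "trop_degree f = (LEAST d. \<exists>T. trop_rep T f \<and> rep_degree T = d)"

text \<open>The template \<open>(0, 1, \<dots>, N - 1)\<close>. An index type carries no canonical order, so the
  positions are given by a numbering \<open>pos\<close> of the index type by \<open>0, \<dots>, N - 1\<close>.\<close>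

definition zstar :: "('n::finite \<Rightarrow> nat) \<Rightarrow> real ^ 'n" where
  "zstar pos = (\<chi> i. real (pos i))"

end

theory Submission
  imports Defs
begin

text \<open>
  Write \<open>z\<close> for \<open>zstar pos\<close>. Everything comes down to the interplay of odd permutations with
  exponent vectors.

  \<^emph>\<open>Below the threshold.\<close> Pairwise distinct natural numbers, \<open>N\<close> of them, sum to at least
  \<open>0 + 1 + \<dots> + (N - 1) = N choose 2\<close>. So in a representation of smaller degree every exponent vector
  \<open>a\<close> has a repeated entry and is fixed by a transposition \<open>\<tau>\<close>. If \<open>g\<close> is odd and the term
  \<open>\<gamma> + \<langle>a, \<cdot>\<rangle>\<close> is active at \<open>g x\<close>, then
  \<open>f (g x) = \<gamma> + \<langle>a, g x\<rangle> = \<gamma> + \<langle>a, \<tau> g x\<rangle> \<le> f (\<tau> g x) = f x\<close>, the last step because \<open>\<tau> g\<close> is even.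
  The same inequality for the inverse of \<open>g\<close> gives equality.

  \<^emph>\<open>At the threshold.\<close> The maximum defining \<open>alt_trace z\<close> is itself a representation of degree
  \<open>N choose 2\<close>. For a transposition \<open>\<rho>\<close>, the value at \<open>\<rho> x\<close> is the maximum of \<open>\<langle>x, g z\<rangle>\<close> over the odd
  \<open>g\<close>, while the value at \<open>x\<close> is the maximum over the even ones. When \<open>x\<close> has distinct entries, the
  maximum over all permutations is attained only once, namely where \<open>g z\<close> is ordered like \<open>x\<close>
  (the strict rearrangement inequality), so the two values cannot agree. In particular
  \<open>alt_trace z\<close> is not symmetric, and the first part then rules out any representation of
  smaller degree.
\<close>

section \<open>The permutation action\<close>

lemma perm_act_nth [simp]: "perm_act g x $ i = x $ inv g i"
  by (simp add: perm_act_def)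

lemma perm_act_comp:
  assumes "g permutes UNIV" "h permutes UNIV"
  shows "perm_act (g \<circ> h) x = perm_act g (perm_act h x)"
  using assms by (simp add: vec_eq_iff o_inv_distrib permutes_bij)

lemma perm_act_inv_cancel:
  assumes "g permutes UNIV"
  shows "perm_act (inv g) (perm_act g x) = x"
  using assms by (simp add: vec_eq_iff permutes_inv_inv permutes_inverses)

lemma inner_perm_act:
  assumes "g permutes UNIV"
  shows "perm_act g x \<bullet> perm_act g y = x \<bullet> y"
proof -
  have "(\<Sum>i\<in>UNIV. x $ inv g i \<bullet> y $ inv g i) = (\<Sum>i\<in>UNIV. x $ i \<bullet> y $ i)"
    using sum.permute[OF permutes_inv[OF assms], of "\<lambda>i. x $ i \<bullet> y $ i"] by (simp add: o_def)
  then show ?thesis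
    by (simp add: inner_vec_def)
qed

lemma inner_perm_act_left:
  assumes "g permutes UNIV"
  shows "perm_act g x \<bullet> y = x \<bullet> perm_act (inv g) y"
proof -
  have "perm_act g x \<bullet> y = perm_act (inv g) (perm_act g x) \<bullet> perm_act (inv g) y"
    using inner_perm_act[OF permutes_inv[OF assms]] by metis
  then show ?thesis
    by (simp add: perm_act_inv_cancel[OF assms])
qed

lemma transpose_permutes_UNIV: "Transposition.transpose a b permutes UNIV"
  by (simp add: permutes_swap_id)

lemma evenperm_comp_UNIV:
  fixes g h :: "'n::finite \<Rightarrow> 'n"
  assumes "g permutes UNIV" "h permutes UNIV"
  shows "evenperm (g \<circ> h) \<longleftrightarrow> (evenperm g \<longleftrightarrow> evenperm h)"
  using assms by (intro evenperm_comp) (auto simp: permutation_permutes)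

lemma evenperm_inv_UNIV:
  fixes g :: "'n::finite \<Rightarrow> 'n"
  assumes "g permutes UNIV"
  shows "evenperm (inv g) \<longleftrightarrow> evenperm g"
  using assms by (intro evenperm_inv) (auto simp: permutation_permutes)

section \<open>Exponent vectors of small degree\<close>

lemma sum_distinct_nat_ge:
  assumes "finite (S :: nat set)"
  shows "card S choose 2 \<le> \<Sum>S"
  using assms
proof (induction rule: finite_linorder_max_induct)
  case empty
  then show ?case by simp
next
  case (insert b A)
  have "card A \<le> card {..<b}"
    using insert.hyps by (intro card_mono) auto
  moreover have "b \<notin> A"
    using insert.hyps by auto
  ultimately show ?case
    using insert by (simp add: numeral_2_eq_2)
qed

lemma sum_lessThan_choose_two: "\<Sum>{0..<n::nat} = n choose 2"
  by (induction n) (auto simp: numeral_2_eq_2)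

lemma small_degree_not_inj:
  fixes a :: "nat ^ 'n::finite"
  assumes "(\<Sum>i\<in>UNIV. a $ i) < CARD('n) choose 2"
  obtains i j where "i \<noteq> j" "a $ i = a $ j"
proof -
  have "\<not> inj (($) a)"
  proof
    assume "inj (($) a)"
    then have "card (range (($) a)) = CARD('n)" "\<Sum>(range (($) a)) = (\<Sum>i\<in>UNIV. a $ i)"
      by (simp_all add: card_image sum.reindex)
    then show False
      using sum_distinct_nat_ge[of "range (($) a)"] assms by simp
  qed
  then show thesis
    using that by (auto simp: inj_def)
qed

section \<open>Even symmetry below the threshold is full symmetry\<close>

lemma trop_rep_term_le:
  assumes "trop_rep T f" "(\<gamma>, a) \<in> T"
  shows "\<gamma> + (\<chi> i. real (a $ i)) \<bullet> x \<le> f x"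
  using assms unfolding trop_rep_def by (auto intro!: Max_ge)

lemma trop_rep_attained:
  assumes "trop_rep T f"
  obtains \<gamma> a where "(\<gamma>, a) \<in> T" "f x = \<gamma> + (\<chi> i. real (a $ i)) \<bullet> x"
proof -
  have "f x \<in> (\<lambda>(\<gamma>, a). \<gamma> + (\<chi> i. real (a $ i)) \<bullet> x) ` T"
    using assms unfolding trop_rep_def by (metis (no_types, lifting) Max_in finite_imageI image_is_empty)
  then show thesis
    using that by auto
qed

lemma trop_degree_attained:
  assumes "tropical_polynomial f"
  obtains T where "trop_rep T f" "rep_degree T = trop_degree f"
proof -
  have "\<exists>T. trop_rep T f \<and> rep_degree T = trop_degree f"
    unfolding trop_degree_def by (rule LeastI_ex) (use assms in \<open>auto simp: tropical_polynomial_def\<close>)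
  then show thesis
    using that by auto
qed

lemma trop_degree_le: "trop_rep T f \<Longrightarrow> trop_degree f \<le> rep_degree T"
  unfolding trop_degree_def by (rule Least_le) auto

text \<open>
  The transposition fixing the exponent vector that is active at \<open>g x\<close> repairs the parity of \<open>g\<close>
  without changing the value of that term.
\<close>

lemma odd_perm_act_le:
  fixes f :: "real ^ 'n::finite \<Rightarrow> real"
  assumes rep: "trop_rep T f" and deg: "rep_degree T < CARD('n) choose 2"
    and inv: "invariant_under alt_perms f"
    and g: "g permutes UNIV" "\<not> evenperm g"
  shows "f (perm_act g x) \<le> f x"
proof -
  obtain \<gamma> a where a: "(\<gamma>, a) \<in> T" "f (perm_act g x) = \<gamma> + (\<chi> i. real (a $ i)) \<bullet> perm_act g x"
    using trop_rep_attained[OF rep] by metis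
  have "(\<Sum>i\<in>UNIV. a $ i) \<le> rep_degree T"
    using rep a(1) unfolding rep_degree_def trop_rep_def by (auto intro!: Max_ge simp: rev_image_eqI)
  then obtain i j where ij: "i \<noteq> j" "a $ i = a $ j"
    using small_degree_not_inj deg by (metis order_le_less_trans)
  define \<tau> where "\<tau> = Transposition.transpose i j"
  have \<tau>: "\<tau> permutes UNIV" "\<not> evenperm \<tau>"
    using ij by (simp_all add: \<tau>_def transpose_permutes_UNIV evenperm_swap)
  have "perm_act \<tau> (\<chi> i. real (a $ i)) = (\<chi> i. real (a $ i))"
    using ij by (auto simp: vec_eq_iff \<tau>_def Transposition.transpose_def)
  then have "f (perm_act g x) = \<gamma> + (\<chi> i. real (a $ i)) \<bullet> perm_act (\<tau> \<circ> g) x"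
    using a(2) inner_perm_act[OF \<tau>(1)] perm_act_comp[OF \<tau>(1) g(1)] by metis
  also have "\<dots> \<le> f (perm_act (\<tau> \<circ> g) x)"
    by (rule trop_rep_term_le[OF rep a(1)])
  also have "\<dots> = f x"
  proof -
    have "\<tau> \<circ> g \<in> alt_perms"
      using \<tau> g by (simp add: alt_perms_def permutes_compose evenperm_comp_UNIV)
    then show ?thesis
      using inv by (simp add: invariant_under_def)
  qed
  finally show ?thesis .
qed

lemma alt_invariant_imp_sym_invariant:
  fixes f :: "real ^ 'n::finite \<Rightarrow> real"
  assumes "tropical_polynomial f" "invariant_under alt_perms f"
    and "trop_degree f < CARD('n) choose 2"
  shows "invariant_under sym_perms f"
  unfolding invariant_under_def
proof (intro ballI allI)
  fix g :: "'n \<Rightarrow> 'n" and x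
  assume "g \<in> sym_perms"
  then have g: "g permutes UNIV"
    by (simp add: sym_perms_def)
  show "f (perm_act g x) = f x"
  proof (cases "evenperm g")
    case True
    then show ?thesis
      using assms(2) g by (simp add: invariant_under_def alt_perms_def)
  next
    case False
    obtain T where T: "trop_rep T f" "rep_degree T < CARD('n) choose 2"
      using trop_degree_attained assms by metis
    note le = odd_perm_act_le[OF T assms(2)]
    have "f (perm_act (inv g) (perm_act g x)) \<le> f (perm_act g x)"
      using False g by (intro le) (auto simp: permutes_inv evenperm_inv_UNIV)
    then show ?thesis
      using le[OF g False, of x] by (simp add: perm_act_inv_cancel[OF g])
  qed
qed

section \<open>Traces of the alternating group\<close>

lemma alt_perms_nonempty: "alt_perms \<noteq> {}"
  using evenperm_id permutes_id unfolding alt_perms_def by blast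

lemma alt_trace_ge: "g \<in> alt_perms \<Longrightarrow> x \<bullet> perm_act g z \<le> alt_trace z x"
  unfolding alt_trace_def by (auto intro!: Max_ge)

lemma alt_trace_attained:
  obtains g where "g \<in> alt_perms" "alt_trace z x = x \<bullet> perm_act g z"
proof -
  have "alt_trace z x \<in> (\<lambda>g. x \<bullet> perm_act g z) ` alt_perms"
    unfolding alt_trace_def by (intro Max_in) (simp_all add: alt_perms_nonempty)
  then show thesis
    using that by auto
qed

lemma alt_trace_invariant:
  fixes z :: "real ^ 'n::finite"
  shows "invariant_under alt_perms (alt_trace z)"
  unfolding invariant_under_def
proof (intro ballI allI antisym)
  fix h :: "'n \<Rightarrow> 'n" and x :: "real ^ 'n"
  assume h: "h \<in> alt_perms"
  then have hp: "h permutes UNIV"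
    by (simp add: alt_perms_def)
  obtain g where g: "g \<in> alt_perms" "alt_trace z (perm_act h x) = perm_act h x \<bullet> perm_act g z"
    using alt_trace_attained .
  then have "alt_trace z (perm_act h x) = x \<bullet> perm_act (inv h \<circ> g) z"
    using hp by (simp add: alt_perms_def inner_perm_act_left perm_act_comp permutes_inv)
  moreover have "inv h \<circ> g \<in> alt_perms"
    using g h by (auto simp: alt_perms_def permutes_compose permutes_inv evenperm_comp_UNIV evenperm_inv_UNIV)
  ultimately show "alt_trace z (perm_act h x) \<le> alt_trace z x"
    using alt_trace_ge by metis
  obtain k where k: "k \<in> alt_perms" "alt_trace z x = x \<bullet> perm_act k z"
    using alt_trace_attained .
  then have "alt_trace z x = perm_act h x \<bullet> perm_act (h \<circ> k) z"
    using hp by (simp add: alt_perms_def inner_perm_act perm_act_comp)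
  moreover have "h \<circ> k \<in> alt_perms"
    using k h by (auto simp: alt_perms_def permutes_compose evenperm_comp_UNIV)
  ultimately show "alt_trace z x \<le> alt_trace z (perm_act h x)"
    using alt_trace_ge by metis
qed

text \<open>
  A template with natural entries makes the defining maximum a homogeneous representation: its
  exponent vectors are rearrangements of the template and so all have the same entry sum.
\<close>

lemma alt_trace_zstar_rep:
  fixes pos :: "'n::finite \<Rightarrow> nat"
  obtains T where "trop_rep T (alt_trace (zstar pos))" "rep_degree T = (\<Sum>i\<in>UNIV. pos i)"
proof
  define T where "T = (\<lambda>g. (0 :: real, \<chi> i. pos (inv g i))) ` alt_perms"
  have "(\<chi> i. real (pos (inv g i))) \<bullet> x = x \<bullet> perm_act g (zstar pos)" for g and x :: "real ^ 'n"
    by (simp add: inner_vec_def zstar_def mult.commute)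
  then show "trop_rep T (alt_trace (zstar pos))"
    by (simp add: trop_rep_def T_def alt_perms_nonempty alt_trace_def image_image)
  have "(\<Sum>i\<in>UNIV. pos (inv g i)) = (\<Sum>i\<in>UNIV. pos i)" if "g \<in> alt_perms" for g
    using that sum.permute[of "inv g" UNIV pos] by (simp add: alt_perms_def permutes_inv o_def)
  then have "(\<lambda>(\<gamma>, a). \<Sum>i\<in>UNIV. a $ i) ` T = {\<Sum>i\<in>UNIV. pos i}"
    using alt_perms_nonempty by (auto simp: T_def image_image)
  then show "rep_degree T = (\<Sum>i\<in>UNIV. pos i)"
    by (simp add: rep_degree_def)
qed

section \<open>The strict rearrangement inequality\<close>

lemma inner_transpose_diff:
  fixes x z :: "real ^ 'n::finite"
  assumes "i \<noteq> j"
  shows "x \<bullet> perm_act (Transposition.transpose i j) z - x \<bullet> z = (x $ i - x $ j) * (z $ j - z $ i)"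
proof -
  let ?d = "\<lambda>k. x $ k * (z $ Transposition.transpose i j k - z $ k)"
  have "x \<bullet> perm_act (Transposition.transpose i j) z - x \<bullet> z = sum ?d UNIV"
    by (simp add: inner_vec_def sum_subtractf right_diff_distrib)
  also have "\<dots> = sum ?d {i, j}"
    by (rule sum.mono_neutral_right) (auto simp: Transposition.transpose_def)
  also have "\<dots> = (x $ i - x $ j) * (z $ j - z $ i)"
    using assms by (simp add: algebra_simps)
  finally show ?thesis .
qed

text \<open>
  Swapping two entries of \<open>perm_act g z\<close> that are ordered against \<open>x\<close> would increase the product.
\<close>

lemma maximizer_ordered_like:
  fixes x z :: "real ^ 'n::finite"
  assumes g: "g permutes UNIV"
    and max: "\<And>h. h permutes UNIV \<Longrightarrow> x \<bullet> perm_act h z \<le> x \<bullet> perm_act g z"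
    and z: "inj (($) z)" and less: "x $ i < x $ j"
  shows "perm_act g z $ i < perm_act g z $ j"
proof -
  let ?\<tau> = "Transposition.transpose i j"
  have "x \<bullet> perm_act (?\<tau> \<circ> g) z \<le> x \<bullet> perm_act g z"
    by (intro max permutes_compose g transpose_permutes_UNIV)
  then have "(x $ i - x $ j) * (perm_act g z $ j - perm_act g z $ i) \<le> 0"
    using inner_transpose_diff[of i j x "perm_act g z"] less
    by (fastforce simp: perm_act_comp[OF transpose_permutes_UNIV g])
  then have "perm_act g z $ i \<le> perm_act g z $ j"
    using less by (auto simp: mult_le_0_iff)
  moreover have "inv g i \<noteq> inv g j"
    using less permutes_inj[OF permutes_inv[OF g]] by (auto dest: injD)
  then have "perm_act g z $ i \<noteq> perm_act g z $ j"
    using z by (auto dest: injD)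
  ultimately show ?thesis
    by simp
qed

text \<open>
  Being ordered like \<open>x\<close> determines a numbering: it must send each index to its rank in \<open>x\<close>.
\<close>

lemma numbering_eq_rank:
  fixes x :: "real ^ 'n::finite" and p :: "'n \<Rightarrow> nat"
  assumes bij: "bij_betw p UNIV {0..<N}"
    and mono: "\<And>i j. x $ i < x $ j \<Longrightarrow> p i < p j" and x: "inj (($) x)"
  shows "p i = card {j. x $ j < x $ i}"
proof -
  have "x $ j < x $ i \<longleftrightarrow> p j < p i" for j
    using mono[of i j] mono[of j i] x by (cases "x $ i" "x $ j" rule: linorder_cases) (auto dest: injD)
  moreover have "p ` {j. p j < p i} = {0..<p i}"
  proof -
    have r: "range p = {0..<N}"
      using bij by (simp add: bij_betw_def)
    then have "p i < N"
      by (metis atLeastLessThan_iff rangeI)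
    then have "{0..<p i} \<subseteq> range p"
      unfolding r by auto
    then show ?thesis
      by auto
  qed
  moreover have "inj_on p {j. p j < p i}"
    using bij by (auto simp: bij_betw_def intro: inj_on_subset)
  ultimately show ?thesis
    using card_image by fastforce
qed

lemma unique_maximizer:
  fixes x :: "real ^ 'n::finite"
  assumes pos: "bij_betw pos UNIV {0..<N}" and x: "inj (($) x)"
    and g: "g permutes UNIV"
      "\<And>k. k permutes UNIV \<Longrightarrow> x \<bullet> perm_act k (zstar pos) \<le> x \<bullet> perm_act g (zstar pos)"
    and h: "h permutes UNIV"
      "\<And>k. k permutes UNIV \<Longrightarrow> x \<bullet> perm_act k (zstar pos) \<le> x \<bullet> perm_act h (zstar pos)"
  shows "g = h"
proof -
  have z: "inj (($) (zstar pos))"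
    using pos by (auto simp: inj_def zstar_def bij_betw_def)
  have rank: "pos (inv k i) = card {j. x $ j < x $ i}"
    if k: "k permutes UNIV"
      "\<And>l. l permutes UNIV \<Longrightarrow> x \<bullet> perm_act l (zstar pos) \<le> x \<bullet> perm_act k (zstar pos)" for k i
  proof (rule numbering_eq_rank[where N = N])
    show "bij_betw (\<lambda>i. pos (inv k i)) UNIV {0..<N}"
      using bij_betw_trans[OF permutes_imp_bij[OF permutes_inv[OF k(1)]] pos] by (simp add: o_def)
    show "pos (inv k i) < pos (inv k j)" if "x $ i < x $ j" for i j
      using maximizer_ordered_like[OF k z that] by (simp add: zstar_def)
  qed (rule x)
  have "inv g = inv h"
    using rank[OF g] rank[OF h] pos by (simp add: fun_eq_iff bij_betw_def inj_def)
  then show ?thesis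
    using g(1) h(1) by (metis permutes_inv_inv)
qed

text \<open>
  If the even and the odd maximum agreed, both would be the maximum over all permutations, which
  would then be attained by permutations of either parity.
\<close>

lemma alt_trace_transpose_neq:
  fixes x :: "real ^ 'n::finite"
  assumes pos: "bij_betw pos UNIV {0..<N}" and x: "inj (($) x)" and "a \<noteq> b"
  shows "alt_trace (zstar pos) x \<noteq> alt_trace (zstar pos) (perm_act (Transposition.transpose a b) x)"
proof
  define \<rho> where "\<rho> = Transposition.transpose a b"
  let ?z = "zstar pos"
  assume "alt_trace ?z x = alt_trace ?z (perm_act (Transposition.transpose a b) x)"
  then have eq: "alt_trace ?z x = alt_trace ?z (perm_act \<rho> x)"
    by (simp add: \<rho>_def)
  have \<rho>: "\<rho> permutes UNIV" "\<not> evenperm \<rho>" "inv \<rho> = \<rho>"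
    using \<open>a \<noteq> b\<close> by (simp_all add: \<rho>_def transpose_permutes_UNIV evenperm_swap)
  have le: "x \<bullet> perm_act k ?z \<le> alt_trace ?z x" if k: "k permutes UNIV" for k
  proof (cases "evenperm k")
    case True
    then show ?thesis
      using k by (intro alt_trace_ge) (simp add: alt_perms_def)
  next
    case False
    then have "\<rho> \<circ> k \<in> alt_perms"
      using k \<rho> by (simp add: alt_perms_def permutes_compose evenperm_comp_UNIV)
    then have "perm_act \<rho> x \<bullet> perm_act (\<rho> \<circ> k) ?z \<le> alt_trace ?z x"
      unfolding eq by (rule alt_trace_ge)
    then show ?thesis
      by (simp add: perm_act_comp[OF \<rho>(1) k] inner_perm_act[OF \<rho>(1)])
  qed
  obtain g where g: "g \<in> alt_perms" "alt_trace ?z x = x \<bullet> perm_act g ?z"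
    using alt_trace_attained .
  obtain h where h: "h \<in> alt_perms" "alt_trace ?z (perm_act \<rho> x) = perm_act \<rho> x \<bullet> perm_act h ?z"
    using alt_trace_attained .
  have gp: "g permutes UNIV" "evenperm g" and hp: "h permutes UNIV" "evenperm h"
    using g h by (simp_all add: alt_perms_def)
  have "alt_trace ?z x = x \<bullet> perm_act (\<rho> \<circ> h) ?z"
    using h(2) eq \<rho> hp(1) by (simp add: inner_perm_act_left perm_act_comp)
  then have "g = \<rho> \<circ> h"
    using le g(2) by (intro unique_maximizer[OF pos x] gp permutes_compose hp \<rho>) auto
  then show False
    using gp(2) hp \<rho> by (simp add: evenperm_comp_UNIV)
qed

section \<open>The exact threshold\<close>

theorem theorem4p8:
  fixes N :: nat and pos :: "'n::finite \<Rightarrow> nat"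
  assumes "CARD('n) = N" and "N \<ge> 2"
    and "bij_betw pos UNIV {0..<N}"
  shows "(\<forall>f :: real ^ 'n \<Rightarrow> real.
            tropical_polynomial f \<longrightarrow> invariant_under alt_perms f \<longrightarrow>
            trop_degree f < N choose 2 \<longrightarrow> invariant_under sym_perms f)
       \<and> tropical_polynomial (alt_trace (zstar pos))
       \<and> invariant_under alt_perms (alt_trace (zstar pos))
       \<and> trop_degree (alt_trace (zstar pos)) = N choose 2
       \<and> (\<forall>(a::'n) b x. a \<noteq> b \<longrightarrow> inj (\<lambda>i. x $ i) \<longrightarrow>
            alt_trace (zstar pos) x \<noteq> alt_trace (zstar pos) (perm_act (Transposition.transpose a b) x))"
proof -
  let ?f = "alt_trace (zstar pos)"
  have below: "invariant_under sym_perms f"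
    if "tropical_polynomial f" "invariant_under alt_perms f" "trop_degree f < N choose 2"
    for f :: "real ^ 'n \<Rightarrow> real"
    using alt_invariant_imp_sym_invariant that assms(1) by blast
  have neq: "?f x \<noteq> ?f (perm_act (Transposition.transpose a b) x)"
    if "a \<noteq> b" "inj (($) x)" for a b and x :: "real ^ 'n"
    using alt_trace_transpose_neq[OF assms(3)] that by blast
  have "(\<Sum>i\<in>UNIV. pos i) = N choose 2"
    using sum.reindex_bij_betw[OF assms(3), of "\<lambda>k. k"] by (simp add: sum_lessThan_choose_two)
  then obtain T where T: "trop_rep T ?f" "rep_degree T = N choose 2"
    using alt_trace_zstar_rep by metis
  then have trop: "tropical_polynomial ?f"
    by (auto simp: tropical_polynomial_def)
  have "\<not> trop_degree ?f < N choose 2"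
  proof
    assume "trop_degree ?f < N choose 2"
    then have sym: "invariant_under sym_perms ?f"
      using below trop alt_trace_invariant by blast
    obtain a b :: 'n where "a \<noteq> b"
      using assms(1,2) card_le_Suc0_iff_eq[of "UNIV :: 'n set"] by fastforce
    \<comment> \<open>The template itself has pairwise distinct entries and serves as the test point.\<close>
    moreover have "inj (($) (zstar pos))"
      using assms(3) by (auto simp: inj_def zstar_def bij_betw_def)
    ultimately show False
      using neq sym transpose_permutes_UNIV
      by (metis invariant_under_def mem_Collect_eq sym_perms_def)
  qed
  then have "trop_degree ?f = N choose 2"
    using trop_degree_le[OF T(1)] T(2) by simp
  then show ?thesis
    using below trop alt_trace_invariant neq by blast
qed

end
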